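(* Let $q$ be a positive integer and let $J,K\subseteq\{0,1,\ldots,2^q-1\}$ with $|J|=|K|=2$. Then the submatrix $H_{J,K}$ of $\mathcal{F}_{2^q}$ is Hadamard if and only if there exist nonnegative integers $\alpha,\beta$ with $\alpha+\beta=q-1$ such that $\mathcal{P}_{2^q}(J)=\{1,2^{q-\alpha}\}$ and $\mathcal{P}_{2^q}(K)=\{1,2^{q-\beta}\}$.
   Context: $\mathcal{F}_m=(e^{2\pi i jk/m})_{0\le j,k\le m-1}$ is the $m\times m$ Fourier matrix. For $J,K\subseteq\{0,\ldots,m-1\}$ with $|J|=|K|=n$, $H_{J,K}=H_{J,K,m}=(e^{2\pi i jk/m})_{j\in J,k\in K}$ is the $n\times n$ submatrix of $\mathcal{F}_m$ with rows $J$ and columns $K$ (each listed in increasing order). An $n\times n$ complex matrix $H$ is Hadamard if all its entries have modulus $1$ and $H^*H=HH^*=nI_n$. For a nonempty finite set $X$ of nonnegative integers, $\mathcal{D}(X)=\{x_1-x_2:x_1,x_2\in X\}$ and $\mathcal{P}_m(X)=\left\{\frac{m}{\gcd(m,d)}:d\in\mathcal{D}(X)\right\}$ (with $\gcd(m,0)=m$). Here $m=2^q$. *)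

theory Defs
  imports
    Complex_Main
    "Jordan_Normal_Form.Schur_Decomposition"
    "Jordan_Normal_Form.DL_Submatrix"
begin

definition fourier_mat :: "nat \<Rightarrow> complex mat" where
  "fourier_mat m =
     mat m m (\<lambda>(j, k). exp (2 * of_real pi * \<i> * of_nat j * of_nat k / of_nat m))"

(* submatrix lists the selected rows and columns in increasing order; indices outside
   the Fourier matrix would be dropped silently, so J and K should be subsets of {0..<m}. *)
definition fourier_submat :: "nat \<Rightarrow> nat set \<Rightarrow> nat set \<Rightarrow> complex mat" where
  "fourier_submat m J K = submatrix (fourier_mat m) J K"

definition hadamard :: "nat \<Rightarrow> complex mat \<Rightarrow> bool" where
  "hadamard n H \<longleftrightarrow>
     H \<in> carrier_mat n n \<and>
     (\<forall>i<n. \<forall>j<n. cmod (H $$ (i, j)) = 1) \<and>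
     mat_adjoint H * H = of_nat n \<cdot>\<^sub>m 1\<^sub>m n \<and>
     H * mat_adjoint H = of_nat n \<cdot>\<^sub>m 1\<^sub>m n"

(* The differences are taken in the integers: natural-number subtraction truncates. *)
definition diff_set :: "nat set \<Rightarrow> int set" where
  "diff_set X = {int x1 - int x2 | x1 x2. x1 \<in> X \<and> x2 \<in> X}"

definition period_set :: "nat \<Rightarrow> nat set \<Rightarrow> int set" where
  "period_set m X = {int m div gcd (int m) d | d. d \<in> diff_set X}"

end

theory Submission
  imports Defs "HOL-Analysis.Complex_Transcendental"
begin

text \<open>
  Put \<open>m = 2 ^ q\<close> and let \<open>J = {a < b}\<close>, \<open>K = {c < d}\<close>. For a two-by-two matrix with unimodular
  entries, orthogonality of the rows and orthogonality of the columns are one and the same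
  equation: the permanent vanishes (\<open>hadamard_2_iff_permanent_eq_0\<close>). For the Fourier submatrix
  this says that \<open>exp (2 pi i x y / m) = - 1\<close>, where \<open>x = b - a\<close> and \<open>y = d - c\<close>. As \<open>m\<close> is a power
  of two, that holds exactly when the square of this root of unity is one but the root itself is
  not, that is, when the 2-adic valuation of \<open>x y\<close> equals \<open>q - 1\<close>
  (\<open>root_of_unity_eq_minus_1_iff\<close>).

  The valuation is additive, so the condition splits \<open>q - 1\<close> into the valuations \<open>\<alpha>\<close> of \<open>x\<close> and
  \<open>\<beta>\<close> of \<open>y\<close>. Since \<open>x < m\<close>, the greatest common divisor of \<open>m\<close> and \<open>x\<close> is \<open>2 ^ \<alpha>\<close>, and hence
  the period set of \<open>J\<close> is \<open>{1, 2 ^ (q - \<alpha>)}\<close>; this set determines \<open>\<alpha>\<close> in turn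
  (\<open>period_set_eq_iff_multiplicity\<close>). The same applies to \<open>K\<close>.
\<close>

lemma obtain_card_2_less:
  fixes A :: "nat set"
  assumes "card A = 2"
  obtains a b where "A = {a, b}" "a < b"
proof -
  obtain a b where "A = {a, b}" "a \<noteq> b" using assms by (auto simp: card_2_iff)
  thus ?thesis using that[of a b] that[of b a] by (cases "a < b") auto
qed

lemma pick_doubleton:
  assumes "a < b"
  shows "pick {a, b} 0 = a" "pick {a, b} (Suc 0) = b"
proof -
  show p0: "pick {a, b} 0 = a" using assms by (auto intro!: Least_equality)
  show "pick {a, b} (Suc 0) = b"
    unfolding pick.simps(2) p0 using assms by (intro Least_equality) auto
qed

text \<open>
  If \<open>p\<close>, \<open>t\<close>, \<open>r\<close>, \<open>s\<close> denote the entries row by row, multiplying the row orthogonality relation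
  \<open>p * cnj r + t * cnj s = 0\<close> by \<open>r * s\<close>, or the column relation \<open>cnj p * t + cnj r * s = 0\<close> by
  \<open>p * r\<close>, gives \<open>p * s + t * r = 0\<close> because the entries are unimodular.
\<close>

lemma hadamard_2_iff_permanent_eq_0:
  assumes H: "H \<in> carrier_mat 2 2"
    and unimodular: "\<And>i j. i < 2 \<Longrightarrow> j < 2 \<Longrightarrow> cmod (H $$ (i, j)) = 1"
  shows "hadamard 2 H \<longleftrightarrow> H $$ (0, 0) * H $$ (1, 1) + H $$ (0, 1) * H $$ (1, 0) = 0"
proof -
  define p t r s where "p = H $$ (0, 0)" and "t = H $$ (0, 1)"
    and "r = H $$ (1, 0)" and "s = H $$ (1, 1)"
  have unit: "cmod p = 1" "cmod t = 1" "cmod r = 1" "cmod s = 1"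
    using unimodular by (auto simp: p_def t_def r_def s_def)
  have entry: "mat_adjoint H $$ (i, j) = cnj (H $$ (j, i))" if "i < 2" "j < 2" for i j
    using H that unfolding mat_adjoint_def by (simp add: mat_of_rows_index)
  have adj: "mat_adjoint H \<in> carrier_mat 2 2"
    using H unfolding mat_adjoint_def by (intro carrier_matI) simp_all
  have norm_sq: "z * cnj z = 1" "cnj z * z = 1" if "cmod z = 1" for z
    using that by (simp_all add: complex_norm_square[symmetric] mult.commute)
  note sq = norm_sq[OF unit(1)] norm_sq[OF unit(2)] norm_sq[OF unit(3)] norm_sq[OF unit(4)]
  have eq_iff: "A = B \<longleftrightarrow> A $$ (0,0) = B $$ (0,0) \<and> A $$ (0,1) = B $$ (0,1) \<and>
      A $$ (1,0) = B $$ (1,0) \<and> A $$ (1,1) = B $$ (1,1)" (is "_ \<longleftrightarrow> ?entries")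
    if "A \<in> carrier_mat 2 2" "B \<in> carrier_mat 2 2" for A B :: "complex mat"
  proof
    assume entries: ?entries
    show "A = B"
    proof (rule eq_matI)
      fix i j assume "i < dim_row B" "j < dim_col B"
      hence "i = 0 \<or> i = 1" "j = 0 \<or> j = 1" using that(2) by auto
      thus "A $$ (i, j) = B $$ (i, j)" using entries by blast
    qed (use that in auto)
  qed simp
  have prod_entry: "(A * B) $$ (i, j) = A $$ (i, 0) * B $$ (0, j) + A $$ (i, 1) * B $$ (1, j)"
    if "A \<in> carrier_mat 2 2" "B \<in> carrier_mat 2 2" "i < 2" "j < 2" for A B :: "complex mat" and i j
    using that by (simp add: scalar_prod_def numeral_2_eq_2)
  have cols: "mat_adjoint H * H = of_nat 2 \<cdot>\<^sub>m 1\<^sub>m 2 \<longleftrightarrow>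
      cnj p * t + cnj r * s = 0 \<and> cnj t * p + cnj s * r = 0"
    using sq by (subst eq_iff) (use H adj in \<open>auto simp: prod_entry entry p_def t_def r_def s_def
      simp del: index_mult_mat\<close>)
  have rows: "H * mat_adjoint H = of_nat 2 \<cdot>\<^sub>m 1\<^sub>m 2 \<longleftrightarrow>
      p * cnj r + t * cnj s = 0 \<and> r * cnj p + s * cnj t = 0"
    using sq by (subst eq_iff) (use H adj in \<open>auto simp: prod_entry entry p_def t_def r_def s_def
      simp del: index_mult_mat\<close>)
  have nz: "p \<noteq> 0" "t \<noteq> 0" "r \<noteq> 0" "s \<noteq> 0" using unit by auto
  have cnj_eq: "cnj p = 1 / p" "cnj t = 1 / t" "cnj r = 1 / r" "cnj s = 1 / s"
    using sq nz by (simp_all add: field_simps)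
  have "cnj p * t + cnj r * s = 0 \<longleftrightarrow> p * s + t * r = 0"
    "cnj t * p + cnj s * r = 0 \<longleftrightarrow> p * s + t * r = 0"
    "p * cnj r + t * cnj s = 0 \<longleftrightarrow> p * s + t * r = 0"
    "r * cnj p + s * cnj t = 0 \<longleftrightarrow> p * s + t * r = 0"
    unfolding cnj_eq using nz by (simp_all add: field_simps)
  thus ?thesis
    unfolding hadamard_def rows cols using H unimodular
    by (auto simp: p_def t_def r_def s_def)
qed

lemma exp_2pi_i_eq_1_iff:
  assumes "m > 0"
  shows "exp (2 * of_real pi * \<i> * of_nat n / of_nat m) = 1 \<longleftrightarrow> m dvd n"
proof -
  have "exp (2 * of_real pi * \<i> * of_nat n / of_nat m) = 1 \<longleftrightarrow>
      (\<exists>k::int. real n = real_of_int k * real m)"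
    using assms by (auto simp: exp_eq_1 field_simps)
  also have "\<dots> \<longleftrightarrow> (\<exists>k::int. int n = k * int m)"
    by (metis of_int_eq_iff of_int_mult of_int_of_nat_eq)
  also have "\<dots> \<longleftrightarrow> int m dvd int n" by (auto simp: dvd_def mult.commute)
  finally show ?thesis by simp
qed

text \<open>Minus one is the only square root of one other than one itself.\<close>

lemma root_of_unity_eq_minus_1_iff:
  assumes "q > 0" "n > 0"
  shows "exp (2 * of_real pi * \<i> * of_nat n / of_nat (2 ^ q)) = - 1 \<longleftrightarrow> multiplicity 2 n = q - 1"
proof -
  define w where "w = exp (2 * of_real pi * \<i> * of_nat n / of_nat (2 ^ q))"
  have w1: "w = 1 \<longleftrightarrow> 2 ^ q dvd n" unfolding w_def by (rule exp_2pi_i_eq_1_iff) simp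
  have "w\<^sup>2 = exp (2 * of_real pi * \<i> * of_nat (2 * n) / of_nat (2 ^ q))"
    unfolding w_def power2_eq_square exp_add[symmetric] by (simp add: field_simps)
  hence "w\<^sup>2 = 1 \<longleftrightarrow> 2 ^ q dvd 2 * n" using exp_2pi_i_eq_1_iff[of "2 ^ q" "2 * n"] by simp
  also have "\<dots> \<longleftrightarrow> 2 ^ (q - 1) dvd n" using assms(1) by (cases q) auto
  finally have w2: "w\<^sup>2 = 1 \<longleftrightarrow> 2 ^ (q - 1) dvd n" .
  have pow: "2 ^ k dvd n \<longleftrightarrow> k \<le> multiplicity 2 n" for k
    using assms(2) by (intro power_dvd_iff_le_multiplicity) auto
  have "w = - 1 \<longleftrightarrow> w\<^sup>2 = 1 \<and> w \<noteq> 1" by (auto simp: power2_eq_1_iff)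
  also have "\<dots> \<longleftrightarrow> multiplicity 2 n = q - 1"
    unfolding w1 w2 pow using assms(1) by auto
  finally show ?thesis unfolding w_def .
qed

text \<open>
  The two terms of the permanent are the roots of unity with exponents \<open>a c + b d\<close> and
  \<open>a d + b c\<close>; they cancel when their quotient, with exponent \<open>(b - a) (d - c)\<close>, is minus one.
\<close>

lemma hadamard_fourier_submat_iff:
  assumes "a < b" "b < m" "c < d" "d < m"
  shows "hadamard 2 (fourier_submat m {a, b} {c, d}) \<longleftrightarrow>
    exp (2 * of_real pi * \<i> * of_nat ((b - a) * (d - c)) / of_nat m) = - 1"
proof -
  define e where "e n = exp (2 * of_real pi * \<i> * of_nat n / of_nat m)" for n
  define H where "H = fourier_submat m {a, b} {c, d}"
  have sets: "{i. i < m \<and> i \<in> {a, b}} = {a, b}" "{i. i < m \<and> i \<in> {c, d}} = {c, d}"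
    using assms by auto
  have card: "card {a, b} = 2" "card {c, d} = 2" using assms by simp_all
  have H: "H \<in> carrier_mat 2 2"
    using assms unfolding H_def fourier_submat_def
    by (intro carrier_matI) (simp_all add: dim_submatrix fourier_mat_def sets card del: insert_iff)
  have entry: "H $$ (i, j) = e (pick {a, b} i * pick {c, d} j)" if "i < 2" "j < 2" for i j
  proof -
    have "pick {a, b} i < m" "pick {c, d} j < m"
      using that assms by (auto simp: less_2_cases_iff pick_doubleton simp del: pick.simps)
    moreover have "H $$ (i, j) = fourier_mat m $$ (pick {a, b} i, pick {c, d} j)"
      using that assms unfolding H_def fourier_submat_def
      by (intro submatrix_index) (simp_all add: fourier_mat_def sets card del: insert_iff)
    ultimately show ?thesis by (simp add: fourier_mat_def e_def mult.assoc)
  qed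
  have unimodular: "cmod (e n) = 1" for n
    using norm_exp_i_times[of "2 * pi * n / m"] by (simp add: e_def mult_ac)
  have e_add: "e k * e l = e (k + l)" for k l
    by (simp add: e_def exp_add[symmetric] add_divide_distrib[symmetric] algebra_simps)
  have shift: "a * c + b * d = (b - a) * (d - c) + (a * d + b * c)"
  proof -
    obtain x y where "b = a + x" "d = c + y" using assms by (metis less_imp_add_positive)
    thus ?thesis by (simp add: algebra_simps)
  qed
  have "hadamard 2 H \<longleftrightarrow> e (a * c) * e (b * d) + e (a * d) * e (b * c) = 0"
    using assms
    by (subst hadamard_2_iff_permanent_eq_0[OF H])
       (auto simp: entry unimodular pick_doubleton simp del: pick.simps)
  also have "\<dots> \<longleftrightarrow> (e ((b - a) * (d - c)) + 1) * e (a * d + b * c) = 0"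
    unfolding e_add shift by (simp only: e_add[symmetric] distrib_right mult_1)
  also have "\<dots> \<longleftrightarrow> e ((b - a) * (d - c)) = - 1"
    by (simp add: e_def add_eq_0_iff2)
  finally show ?thesis by (simp add: H_def e_def)
qed

lemma gcd_prime_power:
  fixes p :: nat
  assumes "prime p" "n > 0"
  shows "gcd (p ^ q) n = p ^ min q (multiplicity p n)"
proof -
  obtain k where k: "k \<le> q" "gcd (p ^ q) n = p ^ k"
    using assms(1) divides_primepow_nat[of p "gcd (p ^ q) n" q] by auto
  have pow: "p ^ j dvd n \<longleftrightarrow> j \<le> multiplicity p n" for j
    using assms by (intro power_dvd_iff_le_multiplicity) (auto dest: prime_gt_1_nat)
  have "p ^ min q (multiplicity p n) dvd p ^ k"
    unfolding k(2)[symmetric] by (simp add: pow le_imp_power_dvd)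
  hence "min q (multiplicity p n) \<le> k"
    using assms(1) by (auto simp: dvd_power_iff_le prime_ge_2_nat)
  moreover have "k \<le> multiplicity p n" unfolding pow[symmetric] k(2)[symmetric] by simp
  ultimately have "k = min q (multiplicity p n)" using k(1) by auto
  thus ?thesis using k(2) by simp
qed

lemma period_set_doubleton:
  assumes "a < b" "m > 0"
  shows "period_set m {a, b} = {1, int (m div gcd m (b - a))}"
proof -
  obtain x where x: "b = a + x" using assms(1) less_imp_add_positive by blast
  have "diff_set X = (\<Union>y\<in>X. (\<lambda>z. int y - int z) ` X)" for X
    unfolding diff_set_def by blast
  hence "diff_set {a, b} = {0, int x, - int x}" by (auto simp: x)
  moreover have "period_set m X = (\<lambda>d. int m div gcd (int m) d) ` diff_set X" for X
    unfolding period_set_def by blast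
  ultimately show ?thesis using assms by (simp add: x zdiv_int)
qed

text \<open>
  The bound \<open>b < 2 ^ q\<close> keeps the valuation of the difference below \<open>q\<close>, so the period
  \<open>2 ^ (q - v)\<close> is not truncated and the valuation \<open>v\<close> can be read off from it.
\<close>

lemma period_set_eq_iff_multiplicity:
  assumes "a < b" "b < 2 ^ q" "\<alpha> < q"
  shows "period_set (2 ^ q) {a, b} = {1, 2 ^ (q - \<alpha>)} \<longleftrightarrow> multiplicity 2 (b - a) = \<alpha>"
proof -
  define v where "v = multiplicity 2 (b - a)"
  have "2 ^ v \<le> b - a" unfolding v_def
    using assms(1) by (intro dvd_imp_le multiplicity_dvd) auto
  hence "(2::nat) ^ v < 2 ^ q" using assms by linarith
  hence vq: "v < q" by simp
  hence "gcd (2 ^ q) (b - a) = 2 ^ v"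
    using gcd_prime_power[of 2 "b - a" q] assms(1) by (simp add: v_def)
  hence "period_set (2 ^ q) {a, b} = {1, 2 ^ (q - v)}"
    using period_set_doubleton[of a b "2 ^ q"] assms(1) vq
    by (simp add: power_diff zdiv_int)
  moreover have "{1, 2 ^ (q - v)} = {1, 2 ^ (q - \<alpha>) :: int} \<longleftrightarrow> (2::int) ^ (q - v) = 2 ^ (q - \<alpha>)"
    by (auto simp: doubleton_eq_iff)
  moreover have "(2::int) ^ (q - v) = 2 ^ (q - \<alpha>) \<longleftrightarrow> v = \<alpha>" using vq assms(3) by auto
  ultimately show ?thesis unfolding v_def by simp
qed

theorem theorem3p1:
  fixes q :: nat and J K :: "nat set"
  assumes "q > 0"
    and "J \<subseteq> {0..<2 ^ q}" and "K \<subseteq> {0..<2 ^ q}"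
    and "card J = 2" and "card K = 2"
  shows "hadamard 2 (fourier_submat (2 ^ q) J K) \<longleftrightarrow>
    (\<exists>\<alpha> \<beta> :: nat. \<alpha> + \<beta> = q - 1 \<and>
       period_set (2 ^ q) J = {1, 2 ^ (q - \<alpha>)} \<and>
       period_set (2 ^ q) K = {1, 2 ^ (q - \<beta>)})"
proof -
  obtain a b where J: "J = {a, b}" "a < b" using obtain_card_2_less[OF assms(4)] .
  obtain c d where K: "K = {c, d}" "c < d" using obtain_card_2_less[OF assms(5)] .
  have bound: "b < 2 ^ q" "d < 2 ^ q" using assms(2,3) J K by auto
  have "hadamard 2 (fourier_submat (2 ^ q) J K) \<longleftrightarrow>
      multiplicity 2 ((b - a) * (d - c)) = q - 1"
    unfolding J(1) K(1) hadamard_fourier_submat_iff[OF J(2) bound(1) K(2) bound(2)]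
    using assms(1) J(2) K(2) by (intro root_of_unity_eq_minus_1_iff) auto
  also have "\<dots> \<longleftrightarrow> multiplicity 2 (b - a) + multiplicity 2 (d - c) = q - 1"
    using J(2) K(2) by (subst prime_elem_multiplicity_mult_distrib) auto
  also have "\<dots> \<longleftrightarrow> (\<exists>\<alpha> \<beta>. \<alpha> + \<beta> = q - 1 \<and>
      multiplicity 2 (b - a) = \<alpha> \<and> multiplicity 2 (d - c) = \<beta>)"
    by auto
  also have "\<dots> \<longleftrightarrow> (\<exists>\<alpha> \<beta>. \<alpha> + \<beta> = q - 1 \<and>
      period_set (2 ^ q) J = {1, 2 ^ (q - \<alpha>)} \<and> period_set (2 ^ q) K = {1, 2 ^ (q - \<beta>)})"
  proof (intro ex_cong1 conj_cong refl)
    fix \<alpha> \<beta> :: nat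
    assume sum: "\<alpha> + \<beta> = q - 1"
    hence "\<alpha> < q" "\<beta> < q" using assms(1) by auto
    thus "multiplicity 2 (b - a) = \<alpha> \<longleftrightarrow> period_set (2 ^ q) J = {1, 2 ^ (q - \<alpha>)}"
      and "multiplicity 2 (d - c) = \<beta> \<longleftrightarrow> period_set (2 ^ q) K = {1, 2 ^ (q - \<beta>)}"
      using period_set_eq_iff_multiplicity J K bound by simp_all
  qed
  finally show ?thesis .
qed

end
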